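(* For $0<x\le\frac{\pi}{4}$ and $0\le p\le1$ let $$\rho_{p,x}=p\,|\psi_x\rangle\langle\psi_x|+(1-p)\Big[\rho^A_x\otimes\frac{\mathbb{I}_2}{2}\Big],$$ where $|\psi_x\rangle=\cos x\,|00\rangle+\sin x\,|11\rangle$ and $\rho^A_x=\mathrm{Tr}_B(|\psi_x\rangle\langle\psi_x|)$. There exist parameters $p,x$ in these ranges for which the sufficient condition for unsteerability $$[\cos(2x)]^2\ge\frac{2p-1}{(2-p)p^3}$$ holds and nevertheless the conditional Rényi 2-entropy is negative, $S_2(A|B)_{\rho_{p,x}}<0$. One such instance is $p=\frac{1}{\sqrt2}$, $x=\frac12\arccos\sqrt{\tfrac17\big(12-4\sqrt2\big)}$.
   Context: The first tensor factor of $\mathbb{C}^2\otimes\mathbb{C}^2$ is system $A$ and the second is system $B$. The displayed inequality is a known sufficient condition (Bowles, Hirsch, Quintino, Brunner, 2016) for $\rho_{p,x}$ to be unsteerable, i.e. to admit a local hidden state model. Rényi 2-entropy: $S_2(\rho)=-\log\mathrm{Tr}(\rho^2)$ (logarithm to base 2). Conditional Rényi 2-entropy: $S_2(A|B)_\rho=S_2(\rho)-S_2(\rho_B)$, where $\rho_B=\mathrm{Tr}_A\rho$. *)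

theory Defs
  imports "HOL-Analysis.Analysis"
begin

text \<open>A vector of \<open>H\<^sub>A \<otimes> H\<^sub>B\<close> is indexed by pairs, the first component belonging to
  system A and the second to system B. The computational basis of a qubit is
  \<open>axis 0 1\<close>, \<open>axis 1 1\<close>, with 0 and 1 the two elements of the numeral type \<open>2\<close>.\<close>

type_synonym 'n cvec = "complex ^ 'n"
type_synonym 'n cmat = "complex ^ 'n ^ 'n"

definition tensor_vec :: "'a::finite cvec \<Rightarrow> 'b::finite cvec \<Rightarrow> ('a \<times> 'b) cvec"
  where "tensor_vec u v = (\<chi> i. u $ fst i * v $ snd i)"

definition tensor_mat :: "'a::finite cmat \<Rightarrow> 'b::finite cmat \<Rightarrow> ('a \<times> 'b) cmat"
  where "tensor_mat M N = (\<chi> i j. M $ fst i $ fst j * N $ snd i $ snd j)"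

definition ket_bra :: "'n::finite cvec \<Rightarrow> 'n cvec \<Rightarrow> 'n cmat"
  where "ket_bra u v = (\<chi> i j. u $ i * cnj (v $ j))"

definition ptrace_A :: "('a::finite \<times> 'b::finite) cmat \<Rightarrow> 'b cmat"
  where "ptrace_A R = (\<chi> j l. \<Sum>i\<in>UNIV. R $ (i, j) $ (i, l))"

definition ptrace_B :: "('a::finite \<times> 'b::finite) cmat \<Rightarrow> 'a cmat"
  where "ptrace_B R = (\<chi> i k. \<Sum>j\<in>UNIV. R $ (i, j) $ (k, j))"

text \<open>For a density matrix \<open>R\<close> the trace of \<open>R\<^sup>2\<close> is a positive real, so taking the
  real part only converts the type.\<close>

definition renyi2 :: "'n::finite cmat \<Rightarrow> real"
  where "renyi2 R = - log 2 (Re (trace (R ** R)))"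

definition cond_renyi2 :: "('a::finite \<times> 'b::finite) cmat \<Rightarrow> real"
  where "cond_renyi2 R = renyi2 R - renyi2 (ptrace_A R)"

definition ket :: "2 \<Rightarrow> 2 cvec"
  where "ket i = axis i 1"

definition psi :: "real \<Rightarrow> (2 \<times> 2) cvec"
  where "psi x = cos x *\<^sub>R tensor_vec (ket 0) (ket 0) + sin x *\<^sub>R tensor_vec (ket 1) (ket 1)"

definition rho_A :: "real \<Rightarrow> 2 cmat"
  where "rho_A x = ptrace_B (ket_bra (psi x) (psi x))"

definition rho :: "real \<Rightarrow> real \<Rightarrow> (2 \<times> 2) cmat"
  where "rho p x = p *\<^sub>R ket_bra (psi x) (psi x)
    + (1 - p) *\<^sub>R tensor_mat (rho_A x) ((1 / 2) *\<^sub>R mat 1)"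

text \<open>The sufficient condition for unsteerability of Bowles, Hirsch, Quintino and Brunner.
  At \<open>p = 0\<close> the quotient is 0 by convention, so the condition is true there, in agreement
  with its multiplied-out form \<open>(cos (2 * x))\<^sup>2 * ((2 - p) * p ^ 3) \<ge> 2 * p - 1\<close>.\<close>

definition unsteerability_condition :: "real \<Rightarrow> real \<Rightarrow> bool"
  where "unsteerability_condition p x \<longleftrightarrow>
    (cos (2 * x))\<^sup>2 \<ge> (2 * p - 1) / ((2 - p) * p ^ 3)"

end

(* The purities are Tr(rho^2) = p^2 + (1 - p^2)/2 * s and Tr(rho_B^2) = p^2 * s + (1 - p^2)/2
   with s = cos(x)^4 + sin(x)^4 = 1 - 2 * sin(x)^2 * cos(x)^2. Their difference is
   (3 * p^2 - 1) * sin(x)^2 * cos(x)^2, so the conditional entropy of an entangled psi_x is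
   negative as soon as p^2 > 1/3. At p = 1/sqrt 2 the given x turns the unsteerability
   condition into an equality. *)
theory Submission imports Defs
begin

lemma sum_UNIV_qubit: "(\<Sum>i\<in>(UNIV::2 set). f i) = f 0 + f 1"
proof -
  \<comment> \<open>\<open>sum_2\<close> enumerates the type as 1 and 2, and the numeral 2 wraps
    around to 0.\<close>
  have "(2::2) = 0" by simp
  then show ?thesis by (metis sum_2 add.commute)
qed

lemma sum_UNIV_two_qubits:
  "(\<Sum>i\<in>(UNIV::(2 \<times> 2) set). f i) = f (0, 0) + f (0, 1) + (f (1, 0) + f (1, 1))"
proof -
  have "(\<Sum>i\<in>UNIV. f i) = (\<Sum>a\<in>UNIV. \<Sum>b\<in>UNIV. f (a, b))"
    by (simp add: sum.cartesian_product flip: UNIV_Times_UNIV)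
  then show ?thesis by (simp add: sum_UNIV_qubit)
qed

lemma psi_nth:
  "psi x $ (i, j) = (if i = j then (if i = 0 then of_real (cos x) else of_real (sin x)) else 0)"
  using exhaust_2[of i] exhaust_2[of j]
  by (auto simp: psi_def tensor_vec_def ket_def axis_def of_real_def)

lemma rho_A_nth:
  "rho_A x $ i $ k = (if i = k then (if i = 0 then of_real ((cos x)\<^sup>2) else of_real ((sin x)\<^sup>2)) else 0)"
  using exhaust_2[of i] exhaust_2[of k]
  by (auto simp: rho_A_def ptrace_B_def ket_bra_def psi_nth sum_UNIV_qubit power2_eq_square)

lemma rho_nth:
  "rho p x $ (i, j) $ (k, l) = of_real p * (psi x $ (i, j) * cnj (psi x $ (k, l)))
     + of_real ((1 - p) / 2) * (if j = l then rho_A x $ i $ k else 0)"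
  by (simp add: rho_def ket_bra_def tensor_mat_def mat_def) (simp add: scaleR_conv_of_real)

lemma purity_rho:
  "trace (rho p x ** rho p x) =
     of_real (p\<^sup>2 + (1 - p\<^sup>2) / 2 * (1 - 2 * ((sin x)\<^sup>2 * (cos x)\<^sup>2)))"
proof -
  define c s where "c = cos x" and "s = sin x"
  have sq: "c\<^sup>2 = 1 - s\<^sup>2" by (simp add: c_def s_def cos_squared_eq)
  \<comment> \<open>The matrix is real symmetric, so this trace is the sum of the squares of its
    entries: four on the diagonal, and \<open>p * c * s\<close> twice, coupling |00> and
    |11>.\<close>
  have "trace (rho p x ** rho p x) = of_real ((p * c\<^sup>2 + (1 - p) / 2 * c\<^sup>2)\<^sup>2
      + (p * s\<^sup>2 + (1 - p) / 2 * s\<^sup>2)\<^sup>2 + 2 * (p * c * s)\<^sup>2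
      + ((1 - p) / 2 * c\<^sup>2)\<^sup>2 + ((1 - p) / 2 * s\<^sup>2)\<^sup>2)"
    by (simp add: trace_def matrix_matrix_mult_def sum_UNIV_two_qubits rho_nth psi_nth rho_A_nth
        flip: c_def s_def) (simp add: power2_eq_square algebra_simps)
  also have "(p * c\<^sup>2 + (1 - p) / 2 * c\<^sup>2)\<^sup>2
      + (p * s\<^sup>2 + (1 - p) / 2 * s\<^sup>2)\<^sup>2 + 2 * (p * c * s)\<^sup>2
      + ((1 - p) / 2 * c\<^sup>2)\<^sup>2 + ((1 - p) / 2 * s\<^sup>2)\<^sup>2
      = p\<^sup>2 + (1 - p\<^sup>2) / 2 * (1 - 2 * (s\<^sup>2 * c\<^sup>2))"
    \<comment> \<open>Distributing squares over products exposes \<open>c\<^sup>2\<close> inside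
      \<open>(p * c * s)\<^sup>2\<close>, so \<open>sq\<close> leaves a polynomial identity in
      \<open>p\<close> and \<open>s\<close>.\<close>
    unfolding power_mult_distrib sq by (simp add: field_simps power2_eq_square)
  finally show ?thesis by (simp only: c_def s_def)
qed

lemma purity_ptrace_A_rho:
  "trace (ptrace_A (rho p x) ** ptrace_A (rho p x)) =
     of_real (p\<^sup>2 * (1 - 2 * ((sin x)\<^sup>2 * (cos x)\<^sup>2)) + (1 - p\<^sup>2) / 2)"
proof -
  define c s where "c = cos x" and "s = sin x"
  have sq: "c\<^sup>2 = 1 - s\<^sup>2" by (simp add: c_def s_def cos_squared_eq)
  \<comment> \<open>Tracing out A kills the coherence between |00> and |11>, so the marginal is
    diagonal. The factor \<open>c\<^sup>2 + s\<^sup>2\<close> is the trace of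
    \<open>rho_A x\<close>, kept unreduced so that the entries agree by ring normalisation
    alone.\<close>
  have "trace (ptrace_A (rho p x) ** ptrace_A (rho p x)) =
      of_real ((p * c\<^sup>2 + (1 - p) / 2 * (c\<^sup>2 + s\<^sup>2))\<^sup>2 + (p * s\<^sup>2 + (1 - p) / 2 * (c\<^sup>2 + s\<^sup>2))\<^sup>2)"
    by (simp add: trace_def matrix_matrix_mult_def ptrace_A_def sum_UNIV_qubit rho_nth psi_nth
        rho_A_nth flip: c_def s_def) (simp add: power2_eq_square algebra_simps)
  also have "(p * c\<^sup>2 + (1 - p) / 2 * (c\<^sup>2 + s\<^sup>2))\<^sup>2 + (p * s\<^sup>2 + (1 - p) / 2 * (c\<^sup>2 + s\<^sup>2))\<^sup>2
      = p\<^sup>2 * (1 - 2 * (s\<^sup>2 * c\<^sup>2)) + (1 - p\<^sup>2) / 2"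
    unfolding sq by (simp add: field_simps power2_eq_square)
  finally show ?thesis by (simp only: c_def s_def)
qed

lemma cond_renyi2_rho_neg:
  assumes p: "1 / 3 < p\<^sup>2" "p\<^sup>2 \<le> 1" and x: "0 < x" "x < pi / 2"
  shows "cond_renyi2 (rho p x) < 0"
proof -
  define t where "t = (sin x)\<^sup>2 * (cos x)\<^sup>2"
  have "0 < sin x" "0 < cos x"
    using x by (auto intro: sin_gt_zero2 cos_gt_zero)
  then have t: "0 < t" by (simp add: t_def)
  \<comment> \<open>This is the square of cos(2x); it bounds \<open>t\<close> by 1/4. The resulting
    positivity of the marginal purity lets strict monotonicity of the logarithm apply.\<close>
  have "0 \<le> ((cos x)\<^sup>2 - (sin x)\<^sup>2)\<^sup>2" by simp
  also have "\<dots> = 1 - 4 * t"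
    unfolding t_def cos_squared_eq by (simp add: algebra_simps power2_eq_square)
  finally have t': "0 < 1 - 2 * t" using t by linarith
  have "0 < p\<^sup>2 * (1 - 2 * t)" using p(1) t' by (intro mult_pos_pos) linarith+
  then have pos: "0 < p\<^sup>2 * (1 - 2 * t) + (1 - p\<^sup>2) / 2" using p(2) by (intro add_pos_nonneg) auto
  have "0 < (3 * p\<^sup>2 - 1) * t" using p(1) t by (intro mult_pos_pos) auto
  then have less: "p\<^sup>2 * (1 - 2 * t) + (1 - p\<^sup>2) / 2 < p\<^sup>2 + (1 - p\<^sup>2) / 2 * (1 - 2 * t)"
    by (simp add: field_simps)
  have "cond_renyi2 (rho p x) =
      log 2 (p\<^sup>2 * (1 - 2 * t) + (1 - p\<^sup>2) / 2) - log 2 (p\<^sup>2 + (1 - p\<^sup>2) / 2 * (1 - 2 * t))"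
    unfolding cond_renyi2_def renyi2_def purity_rho purity_ptrace_A_rho t_def Re_complex_of_real
    by simp
  also have "\<dots> < 0" using pos less by simp
  finally show ?thesis .
qed

text \<open>With \<open>r = sqrt 2\<close>, the relations \<open>r * r = 2\<close> and
  \<open>1 / r = r / 2\<close> collapse all powers of \<open>r\<close> to linear
  expressions.\<close>

lemma unsteerability_bound_inverse_sqrt_2:
  "(2 * (1 / sqrt 2) - 1) / ((2 - 1 / sqrt 2) * (1 / sqrt 2) ^ 3) = 1 / 7 * (12 - 4 * sqrt 2)"
proof -
  define r where "r = sqrt 2"
  have r: "r * r = 2" "1 < r" by (simp_all add: r_def)
  have r2: "1 / r = r / 2" using r by (simp add: field_simps)
  have "(2 - r / 2) * (r / 2) ^ 3 = (4 * r - 2) / 8"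
  proof -
    have "(2 - r / 2) * (r / 2) ^ 3 = (4 * r * (r * r) - (r * r) * (r * r)) / 16"
      by (simp add: field_simps power3_eq_cube)
    then show ?thesis by (simp add: r(1))
  qed
  \<comment> \<open>The claim after cross-multiplication, with numerator \<open>r - 1\<close>;
    \<open>1 < r\<close> keeps \<open>4 * r - 2\<close> away from zero.\<close>
  moreover have "(r - 1) * 8 = 1 / 7 * (12 - 4 * r) * (4 * r - 2)"
    using r(1) by (simp add: field_simps)
  ultimately show ?thesis
    using r(2) by (simp only: r2 flip: r_def) (simp add: field_simps)
qed

theorem mainTheorem6:
  "(\<exists>p x :: real. 0 < x \<and> x \<le> pi / 4 \<and> 0 \<le> p \<and> p \<le> 1 \<and>
      unsteerability_condition p x \<and> cond_renyi2 (rho p x) < 0) \<and>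
   (let p = 1 / sqrt 2; x = 1 / 2 * arccos (sqrt (1 / 7 * (12 - 4 * sqrt 2))) in
      0 < x \<and> x \<le> pi / 4 \<and> 0 \<le> p \<and> p \<le> 1 \<and>
      unsteerability_condition p x \<and> cond_renyi2 (rho p x) < 0)"
proof -
  define p :: real where "p = 1 / sqrt 2"
  define q :: real where "q = 1 / 7 * (12 - 4 * sqrt 2)"
  define x where "x = 1 / 2 * arccos (sqrt q)"
  \<comment> \<open>The bound 5/4 is exactly the threshold for \<open>q < 1\<close>, which makes
    \<open>x\<close> positive; the bound 2 is ample for \<open>0 < q\<close>.\<close>
  have "sqrt 2 < 2" "5 / 4 < sqrt 2"
    by (rule real_less_lsqrt real_less_rsqrt; simp add: power2_eq_square)+
  then have q: "0 < q" "q < 1" by (simp_all add: q_def)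
  then have sqrt_q: "0 < sqrt q" "sqrt q < 1" by simp_all
  have "0 < arccos (sqrt q)" using arccos_lt_bounded[of "sqrt q"] sqrt_q by linarith
  moreover have "arccos (sqrt q) \<le> pi / 2" using sqrt_q by (intro arccos_le_pi2) linarith+
  ultimately have x: "0 < x" "x \<le> pi / 4" by (simp_all add: x_def)
  have p: "0 \<le> p" "p \<le> 1" "p\<^sup>2 = 1 / 2" by (simp_all add: p_def power_divide)
  have "(cos (2 * x))\<^sup>2 = q" using q by (simp add: x_def cos_arccos_abs)
  then have "unsteerability_condition p x"
    unfolding unsteerability_condition_def p_def unsteerability_bound_inverse_sqrt_2
    by (simp add: q_def)
  moreover have "cond_renyi2 (rho p x) < 0"
    using x p by (intro cond_renyi2_rho_neg) auto
  ultimately have inst: "0 < x \<and> x \<le> pi / 4 \<and> 0 \<le> p \<and> p \<le> 1 \<and>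
      unsteerability_condition p x \<and> cond_renyi2 (rho p x) < 0"
    using x p by blast
  \<comment> \<open>The explicit pair also witnesses the existential conjunct; folding restores
    \<open>p\<close> and \<open>x\<close> in the goal.\<close>
  then show ?thesis unfolding Let_def
    by (fold q_def, fold p_def x_def) blast
qed

end
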